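(* Let $X$ be a compact metric space of cardinality greater than $2$ and let $(X,F)$ be a topological dynamical system. If $(X,F)$ has the point-wise specification property, then $h(X,F)>0$.
   Context: Let $(X,d)$ be a compact metric space and $2^X$ the set of all non-empty subsets of $X$, with $d_H(A,B)=\max\{\sup_{x\in A}\inf_{y\in B}d(x,y),\ \sup_{y\in B}\inf_{x\in A}d(x,y)\}$ for $A,B\in2^X$. A topological dynamical system $(X,F)$ is a set-valued function $F:X\to 2^X$ such that $F(x)$ is a non-empty compact set for each $x\in X$. $F^0$ is the identity ($F^0(x)=\{x\}$) and $F^n(x)=\bigcup_{y\in F^{n-1}(x)}F(y)$ for $n\ge1$. $(X,F)$ has the point-wise specification property if for each $\epsilon>0$ there is $M>0$ such that for any $n\ge1$, any $x^1,\dots,x^n\in X$ and any non-negative integers $a_1<a_2<\dots<a_n$ with $a_{i+1}-a_i>M$, there exists $z\in X$ such that $d_H(F^{a_i}(z),\{x^i\})<\epsilon$ for all $i\in\{1,\dots,n\}$. Topological entropy: for $n\in\mathbb{N}$ let $\mathrm{Orb}_n(X,F)=\{(x_0,\dots,x_{n-1})\in X^n : x_{i+1}\in F(x_i)\text{ for }0\le i<n-1\}$, with metric $D_n(\overline{x},\overline{y})=\max_{0\le i<n}d(x_i,y_i)$. A set $E\subset \mathrm{Orb}_n(X,F)$ is $(n,\epsilon)$-separated if $D_n(\overline{x},\overline{y})>\epsilon$ for all distinct $\overline{x},\overline{y}\in E$; it is $(n,\epsilon)$-spanning if for every $\overline{x}\in \mathrm{Orb}_n(X,F)$ there is $\overline{y}\in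 E$ with $D_n(\overline{x},\overline{y})<\epsilon$. Let $s_n(\epsilon)$ be the supremum of cardinalities of $(n,\epsilon)$-separated sets and $r_n(\epsilon)$ the infimum of cardinalities of $(n,\epsilon)$-spanning sets. Then $$h(X,F)=\lim_{\epsilon\to0}\limsup_{n\to\infty}\frac1n\log r_n(\epsilon)=\lim_{\epsilon\to0}\limsup_{n\to\infty}\frac1n\log s_n(\epsilon)$$ (the two expressions are known to coincide). *)

theory Defs
  imports "HOL-Analysis.Analysis"
begin

section \<open>Set-valued dynamical systems\<close>

text \<open>The phase space is a subset \<^term>\<open>X\<close> of a type of class \<^class>\<open>metric_space\<close>;
  the map \<^term>\<open>F\<close> matters only on \<^term>\<open>X\<close>. No continuity of \<^term>\<open>F\<close> is required.\<close>

definition set_valued_system :: "'a::metric_space set \<Rightarrow> ('a \<Rightarrow> 'a set) \<Rightarrow> bool" where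
  "set_valued_system X F \<longleftrightarrow> (\<forall>x\<in>X. F x \<noteq> {} \<and> F x \<subseteq> X \<and> compact (F x))"

primrec set_iterate :: "('a \<Rightarrow> 'a set) \<Rightarrow> nat \<Rightarrow> 'a \<Rightarrow> 'a set" where
  "set_iterate F 0 x = {x}"
| "set_iterate F (Suc n) x = (\<Union>y\<in>set_iterate F n x. F y)"

text \<open>The suprema are taken in the reals, so this is the Hausdorff distance for non-empty
  bounded sets, in particular for all non-empty subsets of a compact space.\<close>

definition hausdorff_distance :: "'a::metric_space set \<Rightarrow> 'a set \<Rightarrow> real" where
  "hausdorff_distance A B =
     max (SUP x\<in>A. INF y\<in>B. dist x y) (SUP y\<in>B. INF x\<in>A. dist x y)"

definition pointwise_specification :: "'a::metric_space set \<Rightarrow> ('a \<Rightarrow> 'a set) \<Rightarrow> bool" where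
  "pointwise_specification X F \<longleftrightarrow>
     (\<forall>\<epsilon>>0. \<exists>M::nat. M > 0 \<and>
       (\<forall>n\<ge>1. \<forall>(x :: nat \<Rightarrow> 'a) (a :: nat \<Rightarrow> nat).
          (\<forall>i\<in>{1..n}. x i \<in> X) \<and>
          (\<forall>i\<in>{1..<n}. a i < a (i + 1) \<and> a (i + 1) - a i > M) \<longrightarrow>
          (\<exists>z\<in>X. \<forall>i\<in>{1..n}. hausdorff_distance (set_iterate F (a i) z) {x i} < \<epsilon>)))"

section \<open>Topological entropy\<close>

text \<open>Elements of \<open>X\<^sup>n\<close> are lists of length \<open>n\<close>.\<close>

definition orbits :: "'a set \<Rightarrow> ('a \<Rightarrow> 'a set) \<Rightarrow> nat \<Rightarrow> 'a list set" where
  "orbits X F n =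
     {xs. length xs = n \<and> set xs \<subseteq> X \<and> (\<forall>i. i + 1 < n \<longrightarrow> xs ! (i + 1) \<in> F (xs ! i))}"

text \<open>For \<open>n = 0\<close> the maximum is over the empty set, hence unspecified; only \<open>n \<ge> 1\<close> is
  relevant, as the entropy is a limit superior in \<open>n\<close>.\<close>

definition orbit_dist :: "nat \<Rightarrow> 'a::metric_space list \<Rightarrow> 'a list \<Rightarrow> real" where
  "orbit_dist n xs ys = Max ((\<lambda>i. dist (xs ! i) (ys ! i)) ` {..<n})"

definition separated_orbits ::
    "'a::metric_space set \<Rightarrow> ('a \<Rightarrow> 'a set) \<Rightarrow> nat \<Rightarrow> real \<Rightarrow> 'a list set \<Rightarrow> bool" where
  "separated_orbits X F n \<epsilon> E \<longleftrightarrow>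
     E \<subseteq> orbits X F n \<and> (\<forall>xs\<in>E. \<forall>ys\<in>E. xs \<noteq> ys \<longrightarrow> orbit_dist n xs ys > \<epsilon>)"

definition spanning_orbits ::
    "'a::metric_space set \<Rightarrow> ('a \<Rightarrow> 'a set) \<Rightarrow> nat \<Rightarrow> real \<Rightarrow> 'a list set \<Rightarrow> bool" where
  "spanning_orbits X F n \<epsilon> E \<longleftrightarrow>
     E \<subseteq> orbits X F n \<and> (\<forall>xs\<in>orbits X F n. \<exists>ys\<in>E. orbit_dist n xs ys < \<epsilon>)"

text \<open>Unlike \<^const>\<open>card\<close>, this sends infinite sets to \<open>\<infinity>\<close> rather than to \<open>0\<close>.\<close>

definition ext_card :: "'a set \<Rightarrow> enat" where
  "ext_card A = (if finite A then enat (card A) else \<infinity>)"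

definition max_separated ::
    "'a::metric_space set \<Rightarrow> ('a \<Rightarrow> 'a set) \<Rightarrow> nat \<Rightarrow> real \<Rightarrow> enat" where
  "max_separated X F n \<epsilon> = (SUP E\<in>{E. separated_orbits X F n \<epsilon> E}. ext_card E)"

definition min_spanning ::
    "'a::metric_space set \<Rightarrow> ('a \<Rightarrow> 'a set) \<Rightarrow> nat \<Rightarrow> real \<Rightarrow> enat" where
  "min_spanning X F n \<epsilon> = (INF E\<in>{E. spanning_orbits X F n \<epsilon> E}. ext_card E)"

definition ln_enat :: "enat \<Rightarrow> ereal" where
  "ln_enat k = (case k of enat m \<Rightarrow> (if m = 0 then - \<infinity> else ereal (ln (real m))) | \<infinity> \<Rightarrow> \<infinity>)"

definition spanning_rate :: "'a::metric_space set \<Rightarrow> ('a \<Rightarrow> 'a set) \<Rightarrow> real \<Rightarrow> ereal" where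
  "spanning_rate X F \<epsilon> = limsup (\<lambda>n. ereal (1 / real n) * ln_enat (min_spanning X F n \<epsilon>))"

definition separated_rate :: "'a::metric_space set \<Rightarrow> ('a \<Rightarrow> 'a set) \<Rightarrow> real \<Rightarrow> ereal" where
  "separated_rate X F \<epsilon> = limsup (\<lambda>n. ereal (1 / real n) * ln_enat (max_separated X F n \<epsilon>))"

text \<open>The entropy may be \<open>\<infinity>\<close>. That the limit exists, and agrees with the one obtained
  from separated sets, is proved below.\<close>

definition topological_entropy :: "'a::metric_space set \<Rightarrow> ('a \<Rightarrow> 'a set) \<Rightarrow> ereal" where
  "topological_entropy X F = Lim (at_right 0) (spanning_rate X F)"

subsection \<open>The two expressions for the entropy coincide\<close>

lemma ext_card_mono: "A \<subseteq> B \<Longrightarrow> ext_card A \<le> ext_card B"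
  by (auto simp: ext_card_def card_mono dest: finite_subset)

lemma ln_enat_mono:
  assumes "k \<le> l" shows "ln_enat k \<le> ln_enat l"
  using assms by (cases k; cases l) (auto simp: ln_enat_def)

lemma limsup_rate_mono:
  assumes "\<And>n. n \<ge> 1 \<Longrightarrow> f n \<le> g n"
  shows "limsup (\<lambda>n. ereal (1 / real n) * ln_enat (f n))
       \<le> limsup (\<lambda>n. ereal (1 / real n) * ln_enat (g n))"
proof (rule Limsup_mono)
  show "\<forall>\<^sub>F n in sequentially.
      ereal (1 / real n) * ln_enat (f n) \<le> ereal (1 / real n) * ln_enat (g n)"
    using eventually_ge_at_top[of 1]
    by eventually_elim (intro ereal_mult_left_mono ln_enat_mono assms, auto)
qed

lemma min_spanning_antimono:
  assumes "\<epsilon> \<le> \<delta>" shows "min_spanning X F n \<delta> \<le> min_spanning X F n \<epsilon>"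
  unfolding min_spanning_def
proof (rule INF_superset_mono)
  show "{E. spanning_orbits X F n \<epsilon> E} \<subseteq> {E. spanning_orbits X F n \<delta> E}"
    using assms unfolding spanning_orbits_def by (force intro: less_le_trans)
qed simp

lemma max_separated_antimono:
  assumes "\<epsilon> \<le> \<delta>" shows "max_separated X F n \<delta> \<le> max_separated X F n \<epsilon>"
  unfolding max_separated_def
proof (rule SUP_subset_mono)
  show "{E. separated_orbits X F n \<delta> E} \<subseteq> {E. separated_orbits X F n \<epsilon> E}"
    using assms unfolding separated_orbits_def by (force intro: le_less_trans)
qed simp

lemma orbit_dist_less_iff:
  assumes "n \<ge> 1"
  shows "orbit_dist n xs ys < \<epsilon> \<longleftrightarrow> (\<forall>i<n. dist (xs ! i) (ys ! i) < \<epsilon>)"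
  using assms unfolding orbit_dist_def by (subst Max_less_iff) (auto simp: lessThan_empty_iff)

lemma orbit_dist_commute: "orbit_dist n xs ys = orbit_dist n ys xs"
  by (simp add: orbit_dist_def dist_commute)

lemma max_separated_le_min_spanning:
  assumes n: "n \<ge> 1"
  shows "max_separated X F n (2 * \<epsilon>) \<le> min_spanning X F n \<epsilon>"
  unfolding max_separated_def min_spanning_def
proof (intro SUP_least INF_greatest, clarify)
  fix E S assume E: "separated_orbits X F n (2 * \<epsilon>) E" and S: "spanning_orbits X F n \<epsilon> S"
  have "\<forall>xs\<in>E. \<exists>ys\<in>S. orbit_dist n xs ys < \<epsilon>"
    using E S unfolding separated_orbits_def spanning_orbits_def by blast
  then obtain f where f: "\<And>xs. xs \<in> E \<Longrightarrow> f xs \<in> S \<and> orbit_dist n xs (f xs) < \<epsilon>"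
    by metis
  have "inj_on f E"
  proof (rule inj_onI, rule ccontr)
    fix xs ys assume *: "xs \<in> E" "ys \<in> E" "f xs = f ys" "xs \<noteq> ys"
    have "dist (xs ! i) (ys ! i) < 2 * \<epsilon>" if "i < n" for i
    proof -
      have "dist (xs ! i) (f xs ! i) < \<epsilon>" "dist (ys ! i) (f xs ! i) < \<epsilon>"
        using f[of xs] f[of ys] * that n by (auto simp: orbit_dist_less_iff)
      then show ?thesis using dist_triangle2[of "xs ! i" "ys ! i" "f xs ! i"] by linarith
    qed
    then have "orbit_dist n xs ys < 2 * \<epsilon>" using n by (simp add: orbit_dist_less_iff)
    then show False using E * unfolding separated_orbits_def by fastforce
  qed
  moreover have "f ` E \<subseteq> S" using f by auto
  ultimately show "ext_card E \<le> ext_card S"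
    unfolding ext_card_def by (auto intro: card_inj_on_le dest: inj_on_finite)
qed

lemma min_spanning_le_max_separated:
  assumes n: "n \<ge> 1" and "0 < \<epsilon>"
  shows "min_spanning X F n (2 * \<epsilon>) \<le> max_separated X F n \<epsilon>"
proof (cases "max_separated X F n \<epsilon>")
  case (enat m)
  let ?P = "\<lambda>E. separated_orbits X F n \<epsilon> E"
  have bound: "finite E \<and> card E \<le> m" if "?P E" for E
  proof -
    have "ext_card E \<le> enat m"
      unfolding enat[symmetric] max_separated_def using that by (intro SUP_upper) auto
    then show ?thesis by (auto simp: ext_card_def split: if_splits)
  qed
  have "?P {}" by (simp add: separated_orbits_def)
  then have "\<exists>E. ?P E \<and> (\<forall>E'. ?P E' \<longrightarrow> card E' \<le> card E)"
    using bound by (intro ex_has_greatest_nat[of ?P "{}" card "m + 1"]) (auto intro: le_imp_less_Suc)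
  then obtain E where E: "?P E" and max: "\<And>E'. ?P E' \<Longrightarrow> card E' \<le> card E" by blast
  have "spanning_orbits X F n (2 * \<epsilon>) E"
    unfolding spanning_orbits_def
  proof (intro conjI ballI)
    show "E \<subseteq> orbits X F n" using E by (simp add: separated_orbits_def)
    fix xs assume xs: "xs \<in> orbits X F n"
    show "\<exists>ys\<in>E. orbit_dist n xs ys < 2 * \<epsilon>"
    proof (rule ccontr)
      assume "\<not> ?thesis"
      then have far: "\<And>ys. ys \<in> E \<Longrightarrow> orbit_dist n xs ys \<ge> 2 * \<epsilon>" by force
      have "orbit_dist n xs xs < 2 * \<epsilon>" using n \<open>0 < \<epsilon>\<close> by (simp add: orbit_dist_less_iff)
      then have "xs \<notin> E" using far by force
      moreover have "?P (insert xs E)"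
        using E xs far \<open>0 < \<epsilon>\<close> unfolding separated_orbits_def
        by (smt (verit) insert_iff insert_subset orbit_dist_commute)
      ultimately show False using max[of "insert xs E"] bound[OF E] by simp
    qed
  qed
  then have "min_spanning X F n (2 * \<epsilon>) \<le> ext_card E"
    unfolding min_spanning_def by (intro INF_lower) auto
  also have "\<dots> \<le> max_separated X F n \<epsilon>"
    unfolding max_separated_def using E by (intro SUP_upper) auto
  finally show ?thesis .
qed simp

lemma antimono_tendsto_SUP_at_right_0:
  fixes f :: "real \<Rightarrow> ereal"
  assumes "\<And>x y. x \<le> y \<Longrightarrow> f y \<le> f x"
  shows "(f \<longlongrightarrow> (SUP x\<in>{0<..}. f x)) (at_right 0)"
proof (rule increasing_tendsto)
  show "\<forall>\<^sub>F x in at_right 0. f x \<le> (SUP x\<in>{0<..}. f x)"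
    using eventually_at_right_less[of 0] by eventually_elim (auto intro: SUP_upper)
  fix u assume "u < (SUP x\<in>{0<..}. f x)"
  then obtain y where y: "0 < y" "u < f y" by (auto simp: less_SUP_iff)
  have "\<forall>x>0. x < y \<longrightarrow> u < f x" using assms y by (meson less_imp_le less_le_trans)
  then show "\<forall>\<^sub>F x in at_right 0. u < f x"
    using y(1) by (auto simp: eventually_at_right[OF y(1)])
qed

theorem topological_entropy_spanning:
  "(spanning_rate X F \<longlongrightarrow> topological_entropy X F) (at_right 0)"
proof -
  have "(spanning_rate X F \<longlongrightarrow> (SUP \<epsilon>\<in>{0<..}. spanning_rate X F \<epsilon>)) (at_right 0)"
    by (rule antimono_tendsto_SUP_at_right_0)
       (simp add: spanning_rate_def limsup_rate_mono min_spanning_antimono)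
  then show ?thesis unfolding topological_entropy_def
    by (metis tendsto_Lim trivial_limit_at_right_real)
qed

theorem topological_entropy_separated:
  "(separated_rate X F \<longlongrightarrow> topological_entropy X F) (at_right 0)"
proof -
  let ?R = "spanning_rate X F" and ?S = "separated_rate X F"
  have SR: "?S (2 * \<epsilon>) \<le> ?R \<epsilon>" for \<epsilon>
    unfolding spanning_rate_def separated_rate_def
    by (intro limsup_rate_mono max_separated_le_min_spanning)
  have RS: "?R (2 * \<epsilon>) \<le> ?S \<epsilon>" if "0 < \<epsilon>" for \<epsilon>
    unfolding spanning_rate_def separated_rate_def
    using that by (intro limsup_rate_mono min_spanning_le_max_separated)
  have R: "(?R \<longlongrightarrow> (SUP \<epsilon>\<in>{0<..}. ?R \<epsilon>)) (at_right 0)"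
    by (rule antimono_tendsto_SUP_at_right_0)
       (simp add: spanning_rate_def limsup_rate_mono min_spanning_antimono)
  have S: "(?S \<longlongrightarrow> (SUP \<epsilon>\<in>{0<..}. ?S \<epsilon>)) (at_right 0)"
    by (rule antimono_tendsto_SUP_at_right_0)
       (simp add: separated_rate_def limsup_rate_mono max_separated_antimono)
  have "(SUP \<epsilon>\<in>{0<..}. ?R \<epsilon>) = (SUP \<epsilon>\<in>{0<..}. ?S \<epsilon>)"
  proof (rule antisym)
    show "(SUP \<epsilon>\<in>{0<..}. ?R \<epsilon>) \<le> (SUP \<epsilon>\<in>{0<..}. ?S \<epsilon>)"
    proof (rule SUP_mono)
      fix \<epsilon> :: real assume "\<epsilon> \<in> {0<..}"
      then show "\<exists>\<delta>\<in>{0<..}. ?R \<epsilon> \<le> ?S \<delta>" using RS[of "\<epsilon> / 2"] by (intro bexI[of _ "\<epsilon> / 2"]) auto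
    qed
    show "(SUP \<epsilon>\<in>{0<..}. ?S \<epsilon>) \<le> (SUP \<epsilon>\<in>{0<..}. ?R \<epsilon>)"
    proof (rule SUP_mono)
      fix \<epsilon> :: real assume "\<epsilon> \<in> {0<..}"
      then show "\<exists>\<delta>\<in>{0<..}. ?S \<epsilon> \<le> ?R \<delta>" using SR[of "\<epsilon> / 2"] by (intro bexI[of _ "\<epsilon> / 2"]) auto
    qed
  qed
  moreover have "topological_entropy X F = (SUP \<epsilon>\<in>{0<..}. ?R \<epsilon>)"
    unfolding topological_entropy_def using R by (simp add: tendsto_Lim)
  ultimately show ?thesis using S by simp
qed

end

(* Fix distinct points p, q of X, let \<epsilon> = dist p q / 3 and let M be the gap that specification
   gives for \<epsilon>. Every word in {p, q} of length n is \<epsilon>-shadowed, at the times 0, M+1, 2(M+1), ...,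
   by all orbits of a suitable point. Orbits that shadow different words are more than \<epsilon> apart,
   so there are 2^n separated orbits of length n(M+1), and the entropy is at least ln 2 / (M+1). *)
theory Submission
  imports Defs
begin

lemma set_iterate_subset:
  assumes "set_valued_system X F" and "z \<in> X"
  shows "set_iterate F n z \<subseteq> X"
  using assms by (induction n) (fastforce simp: set_valued_system_def)+

text \<open>Turns information on the iterated sets of a point into an actual orbit: \<open>F\<close>
  has non-empty values on \<open>X\<close>, so a successor can be chosen at every step.\<close>

lemma orbits_through:
  assumes "set_valued_system X F" and "z \<in> X"
  obtains xs where "xs \<in> orbits X F n" and "\<And>i. i < n \<Longrightarrow> xs ! i \<in> set_iterate F i z"
proof -
  define f where "f = rec_nat z (\<lambda>_ y. SOME y'. y' \<in> F y)"
  have f_Suc: "f (Suc i) = (SOME y. y \<in> F (f i))" for i by (simp add: f_def)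
  \<comment> \<open>Both facts are proved together: the choice of \<open>f (Suc i)\<close> is
    meaningful only if \<open>F (f i)\<close> is non-empty, hence if \<open>f i\<close> lies in
    \<open>X\<close>, and that comes from membership in the iterate.\<close>
  have f_iter: "f i \<in> set_iterate F i z \<and> f (Suc i) \<in> F (f i)" for i
  proof (induction i)
    case 0
    have "F z \<noteq> {}" using assms by (simp add: set_valued_system_def)
    then show ?case using f_Suc[of 0] by (simp add: f_def some_in_eq)
  next
    case (Suc i)
    then have in_iter: "f (Suc i) \<in> set_iterate F (Suc i) z" by auto
    then have "f (Suc i) \<in> X" using set_iterate_subset[OF assms] by blast
    then have "F (f (Suc i)) \<noteq> {}" using assms(1) by (simp add: set_valued_system_def)
    then have "f (Suc (Suc i)) \<in> F (f (Suc i))" by (simp add: f_Suc[of "Suc i"] some_in_eq)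
    with in_iter show ?case by blast
  qed
  have "f i \<in> X" for i using f_iter set_iterate_subset[OF assms] by blast
  then have "map f [0..<n] \<in> orbits X F n" using f_iter by (auto simp: orbits_def)
  then show thesis using f_iter by (intro that[of "map f [0..<n]"]) auto
qed

text \<open>The infimum over a singleton collapses, so the first supremum is that of
  \<open>dist y x\<close> over \<open>A\<close>; boundedness makes this real supremum an upper
  bound. Hence every orbit of a shadowing point shadows, whatever successors are chosen.\<close>

lemma dist_le_hausdorff_distance_singleton:
  assumes "bounded A" and "y \<in> A"
  shows "dist y x \<le> hausdorff_distance A {x}"
proof -
  have "bdd_above ((\<lambda>y. dist y x) ` A)"
    using assms(1) by (metis bdd_above.I2 bounded_any_center dist_commute)
  then have "dist y x \<le> (SUP y\<in>A. dist y x)" using assms(2) by (rule cSUP_upper[rotated])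
  then show ?thesis by (simp add: hausdorff_distance_def)
qed

lemma max_separated_ge_of_specification:
  assumes "compact X" and sys: "set_valued_system X F"
    and spec: "pointwise_specification X F"
    and pq: "p \<in> X" "q \<in> X" "p \<noteq> q"
  obtains M where "\<And>n. n \<ge> 1 \<Longrightarrow>
    enat (2 ^ n) \<le> max_separated X F (n * Suc M) (dist p q / 3)"
proof -
  \<comment> \<open>With a third, points within \<epsilon> of p and of q are more than 3\<epsilon> -
    2\<epsilon> = \<epsilon> apart.\<close>
  define \<epsilon> where "\<epsilon> = dist p q / 3"
  have "\<epsilon> > 0" using pq by (simp add: \<epsilon>_def)
  from spec[unfolded pointwise_specification_def, rule_format, OF this]
  obtain M where M: "\<forall>n\<ge>1. \<forall>(x :: nat \<Rightarrow> 'a) (a :: nat \<Rightarrow> nat).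
      (\<forall>i\<in>{1..n}. x i \<in> X) \<and>
      (\<forall>i\<in>{1..<n}. a i < a (i + 1) \<and> a (i + 1) - a i > M) \<longrightarrow>
      (\<exists>z\<in>X. \<forall>i\<in>{1..n}. hausdorff_distance (set_iterate F (a i) z) {x i} < \<epsilon>)"
    by (elim exE conjE)
  have "enat (2 ^ n) \<le> max_separated X F (n * Suc M) \<epsilon>" if "n \<ge> 1" for n
  proof -
    \<comment> \<open>Specification counts from 1, so the shift makes 0 the first time. Consecutive
      times differ by M + 1, and the last, (n - 1)(M + 1), still fits into an orbit of length n(M +
      1).\<close>
    define a where "a i = (i - 1) * Suc M" for i
    have a_less: "a i < n * Suc M" if "i \<in> {1..n}" for i
      using that unfolding a_def by (intro mult_strict_right_mono) auto
    have a_gap: "\<forall>i\<in>{1..<n}. a i < a (i + 1) \<and> a (i + 1) - a i > M"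
    proof
      fix i assume "i \<in> {1..<n}"
      then obtain k where "i = Suc k" by (cases i) auto
      then show "a i < a (i + 1) \<and> a (i + 1) - a i > M" by (simp add: a_def)
    qed
    \<comment> \<open>A word is encoded by the set \<open>W\<close> of positions that carry the
      letter p.\<close>
    have "\<exists>xs. xs \<in> orbits X F (n * Suc M) \<and>
        (\<forall>i\<in>{1..n}. dist (xs ! a i) (if i \<in> W then p else q) < \<epsilon>)" for W
    proof -
      let ?x = "\<lambda>i. if i \<in> W then p else q"
      have "\<forall>i\<in>{1..n}. ?x i \<in> X" using pq by simp
      then have "\<exists>z\<in>X. \<forall>i\<in>{1..n}.
          hausdorff_distance (set_iterate F (a i) z) {?x i} < \<epsilon>"
        by (intro M[rule_format, OF \<open>n \<ge> 1\<close>, of ?x a] conjI a_gap)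
      then obtain z where z: "z \<in> X" and shadow:
        "\<And>i. i \<in> {1..n} \<Longrightarrow> hausdorff_distance (set_iterate F (a i) z) {?x i} < \<epsilon>"
        by blast
      obtain xs where xs: "xs \<in> orbits X F (n * Suc M)"
        "\<And>i. i < n * Suc M \<Longrightarrow> xs ! i \<in> set_iterate F i z"
        using orbits_through[OF sys z] by blast
      have "dist (xs ! a i) (if i \<in> W then p else q) < \<epsilon>" if "i \<in> {1..n}" for i
      proof -
        have "bounded (set_iterate F (a i) z)"
          using set_iterate_subset[OF sys z] compact_imp_bounded[OF \<open>compact X\<close>]
          by (blast intro: bounded_subset)
        from dist_le_hausdorff_distance_singleton[OF this xs(2)[OF a_less[OF that]]] shadow[OF that]
        show ?thesis by (rule le_less_trans)
      qed
      with xs(1) show ?thesis by blast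
    qed
    then obtain orb where orb: "\<And>W. orb W \<in> orbits X F (n * Suc M)"
      and orb_near: "\<And>W i. i \<in> {1..n} \<Longrightarrow>
        dist (orb W ! a i) (if i \<in> W then p else q) < \<epsilon>"
      by metis
    have far: "orbit_dist (n * Suc M) (orb V) (orb W) > \<epsilon>"
      if VW: "V \<in> Pow {1..n}" "W \<in> Pow {1..n}" "V \<noteq> W" for V W
    proof -
      obtain i where i: "i \<in> {1..n}" "i \<in> V \<longleftrightarrow> i \<notin> W" using VW by blast
      have "dist p q = 3 * \<epsilon>" "dist q p = 3 * \<epsilon>" by (simp_all add: \<epsilon>_def dist_commute)
      then have "dist (if i \<in> V then p else q) (if i \<in> W then p else q) = 3 * \<epsilon>"
        using i(2) by auto
      then have "\<epsilon> < dist (orb V ! a i) (orb W ! a i)"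
        using orb_near[OF i(1), of V] orb_near[OF i(1), of W]
        by metric
      also have "\<dots> \<le> orbit_dist (n * Suc M) (orb V) (orb W)"
        unfolding orbit_dist_def using a_less[OF i(1)] by (intro Max_ge) auto
      finally show ?thesis .
    qed
    let ?E = "orb ` Pow {1..n}"
    \<comment> \<open>An orbit is not \<epsilon>-far from itself, so \<open>far\<close> forces
      distinct words to have distinct orbits, and none of the 2^n words is lost in the
      count.\<close>
    have "orbit_dist (n * Suc M) xs xs < \<epsilon>" for xs :: "'a list"
      using \<open>n \<ge> 1\<close> \<open>\<epsilon> > 0\<close> by (simp add: orbit_dist_less_iff)
    then have "inj_on orb (Pow {1..n})" using far by (metis inj_onI less_asym)
    then have "ext_card ?E = enat (2 ^ n)" by (simp add: ext_card_def card_image card_Pow)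
    moreover have "separated_orbits X F (n * Suc M) \<epsilon> ?E"
      unfolding separated_orbits_def using orb far by blast
    then have "ext_card ?E \<le> max_separated X F (n * Suc M) \<epsilon>"
      unfolding max_separated_def by (intro SUP_upper) auto
    ultimately show ?thesis by simp
  qed
  then show thesis using that unfolding \<epsilon>_def by blast
qed

text \<open>The rate can only grow as the scale shrinks, so its value at \<epsilon> bounds the
  values at all smaller scales from below, and therefore their limit.\<close>

lemma separated_rate_le_topological_entropy:
  assumes "\<epsilon> > 0"
  shows "separated_rate X F \<epsilon> \<le> topological_entropy X F"
proof (rule tendsto_lowerbound[OF topological_entropy_separated])
  show "\<forall>\<^sub>F \<delta> in at_right 0. separated_rate X F \<epsilon> \<le> separated_rate X F \<delta>"
    unfolding eventually_at_right[OF assms] separated_rate_def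
    using assms by (auto intro!: limsup_rate_mono max_separated_antimono)
qed simp

theorem corollary5p11:
  fixes X :: "'a::metric_space set" and F :: "'a \<Rightarrow> 'a set"
  assumes "compact X"
    and "infinite X \<or> card X > 2"
    and "set_valued_system X F"
    and "pointwise_specification X F"
  shows "topological_entropy X F > 0"
proof -
  have "\<not> is_singleton X" "X \<noteq> {}" using assms(2) by (auto simp: is_singleton_altdef)
  then obtain p q where pq: "p \<in> X" "q \<in> X" "p \<noteq> q" by (metis is_singletonI' equals0I)
  obtain M where M: "\<And>n. n \<ge> 1 \<Longrightarrow>
      enat (2 ^ n) \<le> max_separated X F (n * Suc M) (dist p q / 3)"
    using max_separated_ge_of_specification[OF assms(1,3,4) pq] by blast
  let ?rate = "\<lambda>n. ereal (1 / real n) * ln_enat (max_separated X F n (dist p q / 3))"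
  \<comment> \<open>Along multiples of M + 1 the factor n cancels from n ln 2 / (n(M + 1)), leaving
    a bound independent of n.\<close>
  have rate: "ereal (ln 2 / real (Suc M)) \<le> ?rate (n * Suc M)" if "n \<ge> 1" for n
  proof -
    have "ln_enat (enat (2 ^ n)) = ereal (real n * ln 2)"
      by (simp add: ln_enat_def ln_realpow)
    then have "ereal (ln 2 / real (Suc M))
        = ereal (1 / real (n * Suc M)) * ln_enat (enat (2 ^ n))"
      using that by (simp del: of_nat_Suc mult_Suc_right)
    also have "\<dots> \<le> ?rate (n * Suc M)"
      by (intro ereal_mult_left_mono ln_enat_mono M that) auto
    finally show ?thesis .
  qed
  have "0 < ereal (ln 2 / real (Suc M))" by simp
  also have "\<dots> \<le> separated_rate X F (dist p q / 3)"
    unfolding separated_rate_def limsup_INF_SUP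
  proof (rule INF_greatest)
    fix n :: nat
    \<comment> \<open>For the limit superior it suffices that every tail contains a multiple of M +
      1; the multiplier \<open>Suc n\<close> keeps it positive even for the tail from 0.\<close>
    have "ereal (ln 2 / real (Suc M)) \<le> ?rate (Suc n * Suc M)" by (rule rate) simp
    also have "\<dots> \<le> (SUP m\<in>{n..}. ?rate m)"
      by (rule SUP_upper) simp
    finally show "ereal (ln 2 / real (Suc M)) \<le> (SUP m\<in>{n..}. ?rate m)" .
  qed
  also have "\<dots> \<le> topological_entropy X F"
    using pq by (intro separated_rate_le_topological_entropy) simp
  finally show ?thesis .
qed

end
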